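(* Let $m\ge 2$ and $n\ge 1$ be integers. Let $Z(m,n,\mathbb{C},0)$ be the exact upper bound (the supremum) of the number of zeros $\#\{t\in\mathcal{D}: I(t)=0\}$ of the function $I(t)=\int_{\gamma(t)}\omega$, taken over all polynomials $f\in\mathbb{C}[x]$ with $\deg f\le m$, all polynomials $\omega\in\mathbb{C}[x]$ with $\deg\omega\le n$, all simply connected domains $\mathcal{D}\subset\mathbb{C}\setminus\Sigma$, where $\Sigma$ is the set of critical values of $f$, and all continuous families of simple cycles $\gamma(t)$, $t\in\mathcal{D}$, in the fibers of $f$, such that $I$ is not identically zero on $\mathcal{D}$. Then $$n-1-\left[\frac{n}{m}\right]\ \le\ Z(m,n,\mathbb{C},0)\ \le\ \frac{(m-1)(n-1)}{2},$$ where $[\cdot]$ denotes the integer part.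
   Context: For a polynomial $f\in\mathbb{C}[x]$ put $L_t=f^{-1}(t)=\{x\in\mathbb{C}: f(x)=t\}$. A critical value of $f$ is a number $f(c)$ with $f'(c)=0$. A simple cycle in $L_t$ is a formal difference $x_i-x_j$ of two distinct points $x_i,x_j\in L_t$, an element of the reduced homology group $H_0(L_t,\mathbb{Z})=\{\sum n_i x_i: x_i\in L_t,\ n_i\in\mathbb{Z},\ \sum n_i=0\}$. A continuous family of simple cycles on $\mathcal{D}$ is $\gamma(t)=x_i(t)-x_j(t)$, where $x_i,x_j:\mathcal{D}\to\mathbb{C}$ are continuous functions with $f(x_i(t))=f(x_j(t))=t$ and $x_i(t)\ne x_j(t)$ for all $t\in\mathcal{D}$. For $\omega\in\mathbb{C}[x]$ the (zero-dimensional) Abelian integral is $\int_{\gamma(t)}\omega=\omega(x_i(t))-\omega(x_j(t))$. *)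

theory Defs
  imports
    "HOL-Analysis.Analysis"
    "HOL-Computational_Algebra.Polynomial"
    "HOL-Library.Poly_Mapping"
    "HOL-Library.Extended_Real"
begin

definition fiber :: "complex poly \<Rightarrow> complex \<Rightarrow> complex set" where
  "fiber f t = {x. poly f x = t}"

definition critical_values :: "complex poly \<Rightarrow> complex set" where
  "critical_values f = {poly f c |c. poly (pderiv f) c = 0}"

text \<open>
  Formal integer combinations of points are elements of the free abelian group
  \<^typ>\<open>complex \<Rightarrow>\<^sub>0 int\<close>. Only the values \<open>\<gamma> t\<close> with \<open>t \<in> D\<close> matter; the values of
  \<open>\<gamma>\<close> outside \<open>D\<close> are left unconstrained.
\<close>

definition continuous_simple_cycle_family ::
    "complex poly \<Rightarrow> complex set \<Rightarrow> (complex \<Rightarrow> (complex \<Rightarrow>\<^sub>0 int)) \<Rightarrow> bool" where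
  "continuous_simple_cycle_family f D \<gamma> \<longleftrightarrow>
     (\<exists>x y. continuous_on D x \<and> continuous_on D y \<and>
        (\<forall>t\<in>D. x t \<in> fiber f t \<and> y t \<in> fiber f t \<and> x t \<noteq> y t \<and>
               \<gamma> t = frag_of (x t) - frag_of (y t)))"

text \<open>
  The integral of \<open>\<omega>\<close> along a zero-dimensional chain \<open>\<Sum> n\<^sub>i x\<^sub>i\<close> is \<open>\<Sum> n\<^sub>i \<omega>(x\<^sub>i)\<close>.
\<close>

definition chain_integral :: "(complex \<Rightarrow>\<^sub>0 int) \<Rightarrow> complex poly \<Rightarrow> complex" where
  "chain_integral c \<omega> =
     (\<Sum>x\<in>Poly_Mapping.keys c. of_int (Poly_Mapping.lookup c x) * poly \<omega> x)"

lemma chain_integral_simple_cycle: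
  assumes "x \<noteq> y"
  shows "chain_integral (frag_of x - frag_of y) \<omega> = poly \<omega> x - poly \<omega> y"
proof -
  have "Poly_Mapping.keys (frag_of x - frag_of y) = {x, y}"
    using assms by (auto simp: in_keys_iff lookup_minus split: if_splits)
  then show ?thesis
    using assms by (simp add: chain_integral_def lookup_minus)
qed

definition simply_connected_domain :: "complex set \<Rightarrow> bool" where
  "simply_connected_domain D \<longleftrightarrow>
     D \<noteq> {} \<and> open D \<and> connected D \<and> simply_connected D"

definition number_of_zeros :: "(complex \<Rightarrow> complex) \<Rightarrow> complex set \<Rightarrow> enat" where
  "number_of_zeros h D =
     (if finite {t\<in>D. h t = 0} then enat (card {t\<in>D. h t = 0}) else \<infinity>)"

text \<open>
  \<open>Z_complex m n\<close> stands for \<open>Z(m, n, \<complex>, 0)\<close>. The supremum is taken in \<^typ>\<open>enat\<close>,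
  so that its finiteness is not presupposed.
\<close>

definition Z_complex :: "nat \<Rightarrow> nat \<Rightarrow> enat" where
  "Z_complex m n =
     Sup {number_of_zeros (\<lambda>t. chain_integral (\<gamma> t) \<omega>) D |f \<omega> D \<gamma>.
            degree f \<le> m \<and> degree \<omega> \<le> n \<and>
            simply_connected_domain D \<and> D \<subseteq> - critical_values f \<and>
            continuous_simple_cycle_family f D \<gamma> \<and>
            (\<exists>t\<in>D. chain_integral (\<gamma> t) \<omega> \<noteq> 0)}"

end

(* Upper bound. Put Q(x,y) = (omega(x) - omega(y))/(x - y); the zeros of I are those of
   g(t) = Q(x_i(t), x_j(t)). The product of Q + e over all ordered pairs of distinct points of the
   fibre over t is holomorphic off the critical values and, since the points of the fibre are
   O(|t|^(1/d)), d = deg f, it is O(|t|^((d-1)(n-1))). So it extends to a polynomial of degree at most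
   (d-1)(n-1). Each solution of g(t) = -e is a double zero of it, because Q is symmetric and both
   (x_i, x_j) and (x_j, x_i) contribute a vanishing factor. For e = 0 the product may vanish
   identically, but by the open mapping theorem g(t) = -e has, for generic small e, at least as many
   solutions as any prescribed finite number of zeros of g.

   Lower bound. For f = x^m and x_j = zeta x_i with zeta a primitive m-th root of unity, I is a
   combination of the independent functions t^(k/m), 1 <= k <= n, m not dividing k, with arbitrary
   coefficients. There are n - [n/m] of them, so a nontrivial combination vanishes at any
   n - 1 - [n/m] given points. *)

theory Submission
  imports Defs "HOL-Complex_Analysis.Complex_Analysis"
    "HOL-Computational_Algebra.Fundamental_Theorem_Algebra"
begin

subsection \<open>Fibres of a polynomial\<close>

lemma fiber_eq_roots: "fiber f t = {x. poly (f - [:t:]) x = 0}"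
  by (auto simp: fiber_def)

lemma degree_diff_const: "degree (f - [:t:]) = degree f"
  if "degree f > 0" for f :: "complex poly"
proof -
  have "degree [:t:] < degree f" using that by simp
  then have "degree (f + (- [:t:])) = degree f" by (intro degree_add_eq_left) simp
  then show ?thesis by (simp only: diff_conv_add_uminus)
qed

lemma finite_fiber: "finite (fiber f t)" if "degree f > 0"
  unfolding fiber_eq_roots by (rule poly_roots_finite) (use that degree_diff_const[OF that, of t] in auto)

lemma card_fiber_le: "card (fiber f t) \<le> degree f" if "degree f > 0"
  unfolding fiber_eq_roots degree_diff_const[OF that, of t, symmetric]
  by (rule card_poly_roots_bound) (use that degree_diff_const[OF that, of t] in auto)

text \<open>A multiple root of \<open>f - [:t:]\<close> is a critical point of \<open>f\<close>
  lying over \<open>t\<close>. Off the critical values all roots are therefore simple, and counting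
  them without multiplicity already gives the degree.\<close>

lemma card_fiber:
  assumes "degree f > 0" and "t \<notin> critical_values f"
  shows "card (fiber f t) = degree f"
proof -
  define q where "q = f - [:t:]"
  have q: "q \<noteq> 0" using degree_diff_const[OF assms(1), of t] assms(1) by (auto simp: q_def)
  have dq: "pderiv q = pderiv f" by (simp add: q_def pderiv_diff pderiv_pCons)
  have sq: "rsquarefree q"
    unfolding rsquarefree_roots dq using assms(2) by (auto simp: critical_values_def q_def)
  have "degree q = size (proots q)" by (simp add: size_proots_complex)
  also have "\<dots> = (\<Sum>x | poly q x = 0. order x q)"
    using q by (simp add: size_multiset_overloaded_eq)
  also have "\<dots> = (\<Sum>x | poly q x = 0. 1)"
    by (intro sum.cong) (use rsquarefree_root_order[OF sq] q in auto)
  finally show ?thesis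
    using degree_diff_const[OF assms(1), of t] by (simp add: fiber_eq_roots q_def)
qed

lemma finite_critical_values: "finite (critical_values f)" if "degree f > 0"
proof -
  have "critical_values f = poly f ` {c. poly (pderiv f) c = 0}"
    by (auto simp: critical_values_def)
  moreover have "pderiv f \<noteq> 0" using that by (simp add: pderiv_eq_0_iff)
  ultimately show ?thesis by (simp add: poly_roots_finite)
qed

text \<open>Inverse function theorem: near a noncritical point \<open>f\<close> is injective with
  open image, and its holomorphic inverse is a section defined near \<open>poly f a\<close>.\<close>

lemma poly_local_section:
  fixes f :: "complex poly"
  assumes "poly (pderiv f) a \<noteq> 0"
  obtains \<phi> where "\<phi> (poly f a) = a" "\<phi> field_differentiable at (poly f a)"
    "\<forall>\<^sub>F t in nhds (poly f a). poly f (\<phi> t) = t"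
proof -
  have hol: "poly f holomorphic_on UNIV" by (intro holomorphic_intros)
  have "deriv (poly f) a \<noteq> 0" using assms by (simp add: DERIV_imp_deriv[OF poly_DERIV])
  then obtain r where r: "r > 0" "open (poly f ` ball a r)" "inj_on (poly f) (ball a r)"
    using has_complex_derivative_locally_invertible[OF hol] by blast
  have hol': "poly f holomorphic_on ball a r" by (intro holomorphic_intros)
  obtain g where g: "g holomorphic_on (poly f ` ball a r)" "\<And>z. z \<in> ball a r \<Longrightarrow> g (poly f z) = z"
    using holomorphic_has_inverse[OF hol' open_ball r(3)] by metis
  have mem: "poly f a \<in> poly f ` ball a r" using r(1) by simp
  show thesis
  proof
    show "g (poly f a) = a" using g(2) r(1) by simp
    show "g field_differentiable at (poly f a)"
      using g(1) r(2) mem holomorphic_on_imp_differentiable_at by blast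
    show "\<forall>\<^sub>F t in nhds (poly f a). poly f (g t) = t"
      unfolding eventually_nhds using r(2) mem g(2) by (intro exI[of _ "poly f ` ball a r"]) auto
  qed
qed

text \<open>Sections through distinct points stay distinct nearby, so they embed the fibre over
  \<open>t0\<close> into the neighbouring fibres. Those have at most \<open>degree f\<close> points,
  a number attained over \<open>t0\<close>, so the embedding is onto.\<close>

lemma fiber_local_sections:
  assumes deg: "degree f > 0" and t0: "t0 \<notin> critical_values f"
  obtains \<phi> where "\<And>a. a \<in> fiber f t0 \<Longrightarrow> \<phi> a t0 = a"
    "\<And>a. a \<in> fiber f t0 \<Longrightarrow> \<phi> a field_differentiable at t0"
    "\<forall>\<^sub>F t in nhds t0. bij_betw (\<lambda>a. \<phi> a t) (fiber f t0) (fiber f t)"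
proof -
  have "\<exists>\<phi>. \<phi> t0 = a \<and> \<phi> field_differentiable at t0 \<and> (\<forall>\<^sub>F t in nhds t0. poly f (\<phi> t) = t)"
    if "a \<in> fiber f t0" for a
  proof -
    have a: "poly f a = t0" using that by (simp add: fiber_def)
    have "poly (pderiv f) a \<noteq> 0" using t0 a by (auto simp: critical_values_def)
    then show ?thesis using poly_local_section[of f a] a by metis
  qed
  then obtain \<phi> where \<phi>: "\<And>a. a \<in> fiber f t0 \<Longrightarrow> \<phi> a t0 = a"
    "\<And>a. a \<in> fiber f t0 \<Longrightarrow> \<phi> a field_differentiable at t0"
    "\<And>a. a \<in> fiber f t0 \<Longrightarrow> \<forall>\<^sub>F t in nhds t0. poly f (\<phi> a t) = t"
    by metis
  note fin = finite_fiber[OF deg]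
  have ne: "\<forall>\<^sub>F t in nhds t0. \<phi> a t \<noteq> \<phi> b t"
    if ab: "a \<in> fiber f t0" "b \<in> fiber f t0" "a \<noteq> b" for a b
  proof -
    have "(\<phi> a \<longlongrightarrow> \<phi> a t0) (nhds t0)" "(\<phi> b \<longlongrightarrow> \<phi> b t0) (nhds t0)"
      using \<phi>(2)[OF ab(1), THEN field_differentiable_imp_continuous_at]
        \<phi>(2)[OF ab(2), THEN field_differentiable_imp_continuous_at]
      by (simp_all add: isCont_def tendsto_nhds_iff)
    then have "((\<lambda>t. \<phi> a t - \<phi> b t) \<longlongrightarrow> a - b) (nhds t0)"
      using \<phi>(1) ab by (auto intro: tendsto_diff)
    then have "\<forall>\<^sub>F t in nhds t0. \<phi> a t - \<phi> b t \<noteq> 0"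
      using ab(3) by (intro tendsto_imp_eventually_ne) auto
    then show ?thesis by (auto elim: eventually_mono)
  qed
  have "\<forall>\<^sub>F t in nhds t0. \<forall>a\<in>fiber f t0. poly f (\<phi> a t) = t"
    using \<phi>(3) fin by (intro eventually_ball_finite) auto
  moreover have "\<forall>\<^sub>F t in nhds t0. \<forall>a\<in>fiber f t0. \<forall>b\<in>fiber f t0. a \<noteq> b \<longrightarrow> \<phi> a t \<noteq> \<phi> b t"
    using ne fin by (intro eventually_ball_finite ballI) (auto simp: eventually_conj_iff intro: eventually_mono)
  ultimately have "\<forall>\<^sub>F t in nhds t0. bij_betw (\<lambda>a. \<phi> a t) (fiber f t0) (fiber f t)"
  proof eventually_elim
    case (elim t)
    have inj: "inj_on (\<lambda>a. \<phi> a t) (fiber f t0)" using elim(2) by (auto simp: inj_on_def)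
    have sub: "(\<lambda>a. \<phi> a t) ` fiber f t0 \<subseteq> fiber f t" using elim(1) by (auto simp: fiber_def)
    have "card (fiber f t) \<le> card ((\<lambda>a. \<phi> a t) ` fiber f t0)"
      using card_fiber_le[OF deg] card_fiber[OF deg t0] card_image[OF inj] by simp
    then have "(\<lambda>a. \<phi> a t) ` fiber f t0 = fiber f t"
      using card_seteq[OF fin sub] by simp
    with inj show ?case by (simp add: bij_betw_def)
  qed
  then show thesis using that \<phi>(1,2) by blast
qed

text \<open>Upgrades the continuous endpoints of a cycle family to holomorphic ones: a continuous
  right inverse of \<open>f\<close> is differentiable wherever the derivative of \<open>f\<close>
  does not vanish at its value.\<close>

lemma section_field_differentiable:
  assumes D: "open D" "t \<in> D" "t \<notin> critical_values f"
    and x: "continuous_on D x" "\<And>s. s \<in> D \<Longrightarrow> x s \<in> fiber f s"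
  shows "x field_differentiable at t"
proof -
  have "poly (pderiv f) (x t) \<noteq> 0"
    using D x(2)[OF D(2)] by (auto simp: critical_values_def fiber_def)
  then have "(x has_field_derivative inverse (poly (pderiv f) (x t))) (at t)"
    using x D by (intro has_field_derivative_inverse_basic[where f = "poly f" and t = D] poly_DERIV)
      (auto simp: fiber_def continuous_on_eq_continuous_at)
  then show ?thesis by (auto simp: field_differentiable_def)
qed

section \<open>Growth of divided differences and of the points of a fibre\<close>

lemma norm_diff_power_le:
  fixes x y :: complex
  assumes "norm x \<le> \<rho>" "norm y \<le> \<rho>" 
  shows "norm (x ^ k - y ^ k) \<le> real k * \<rho> ^ (k - 1) * norm (x - y)"
proof -
  have "norm (\<Sum>i<k. y ^ (k - Suc i) * x ^ i) \<le> (\<Sum>i<k. \<rho> ^ (k - 1))"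
  proof (intro sum_norm_le)
    fix i assume i: "i \<in> {..<k}"
    have "norm (y ^ (k - Suc i) * x ^ i) \<le> \<rho> ^ (k - Suc i) * \<rho> ^ i"
      unfolding norm_mult norm_power
      using assms order_trans[OF norm_ge_zero assms(1)] by (intro mult_mono power_mono) auto
    also have "\<dots> = \<rho> ^ (k - 1)" using i by (simp flip: power_add)
    finally show "norm (y ^ (k - Suc i) * x ^ i) \<le> \<rho> ^ (k - 1)" .
  qed
  then have "norm (x - y) * norm (\<Sum>i<k. y ^ (k - Suc i) * x ^ i) \<le> norm (x - y) * (real k * \<rho> ^ (k - 1))"
    by (intro mult_left_mono) auto
  then show ?thesis
    by (simp add: power_diff_sumr2 norm_mult mult_ac)
qed

text \<open>The quotient Q of the proof idea. On the diagonal it takes the value 0 of division by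
  zero, not the derivative of \<open>\<omega>\<close>; zeros are only counted off the
  diagonal.\<close>

definition divided_difference :: "complex poly \<Rightarrow> complex \<Rightarrow> complex \<Rightarrow> complex" where
  "divided_difference \<omega> x y = (poly \<omega> x - poly \<omega> y) / (x - y)"

lemma divided_difference_commute: "divided_difference \<omega> x y = divided_difference \<omega> y x"
  by (metis divided_difference_def minus_diff_eq minus_divide_divide)

lemma divided_difference_bound:
  assumes "degree \<omega> \<le> n"
  obtains C where "C \<ge> 1"
    "\<And>x y \<rho>. \<lbrakk>norm x \<le> \<rho>; norm y \<le> \<rho>; 1 \<le> \<rho>\<rbrakk> \<Longrightarrow> norm (divided_difference \<omega> x y) \<le> C * \<rho> ^ (n - 1)"
proof
  \<comment> \<open>The summand 1 gives \<open>C \<ge> 1\<close>. This is needed later, when bounds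
    of single factors are raised to a power larger than the number of factors.\<close>
  define C where "C = 1 + (\<Sum>k\<le>n. norm (coeff \<omega> k) * real k)"
  have C0: "(\<Sum>k\<le>n. norm (coeff \<omega> k) * real k) \<ge> 0" by (intro sum_nonneg) auto
  then show C1: "C \<ge> 1" by (simp add: C_def)
  fix x y :: complex and \<rho> :: real
  assume x: "norm x \<le> \<rho>" and y: "norm y \<le> \<rho>" and \<rho>: "1 \<le> \<rho>"
  have "poly \<omega> x - poly \<omega> y = (\<Sum>k\<le>n. coeff \<omega> k * (x ^ k - y ^ k))"
    using arg_cong[OF poly_as_sum_of_monoms'[OF assms], of "\<lambda>p. poly p x"]
      arg_cong[OF poly_as_sum_of_monoms'[OF assms], of "\<lambda>p. poly p y"]
    by (simp add: poly_sum poly_monom sum_subtractf right_diff_distrib)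
  also have "norm \<dots> \<le> (\<Sum>k\<le>n. norm (coeff \<omega> k) * real k * (\<rho> ^ (n - 1) * norm (x - y)))"
  proof (intro sum_norm_le)
    fix k assume k: "k \<in> {..n}"
    have "norm (x ^ k - y ^ k) \<le> real k * \<rho> ^ (k - 1) * norm (x - y)"
      by (rule norm_diff_power_le[OF x y])
    also have "\<dots> \<le> real k * \<rho> ^ (n - 1) * norm (x - y)"
      using k \<rho> by (intro mult_right_mono mult_left_mono power_increasing) auto
    finally have "norm (x ^ k - y ^ k) \<le> real k * \<rho> ^ (n - 1) * norm (x - y)" .
    then have "norm (coeff \<omega> k) * norm (x ^ k - y ^ k) \<le> norm (coeff \<omega> k) * (real k * \<rho> ^ (n - 1) * norm (x - y))"
      by (intro mult_left_mono) auto
    then show "norm (coeff \<omega> k * (x ^ k - y ^ k)) \<le> norm (coeff \<omega> k) * real k * (\<rho> ^ (n - 1) * norm (x - y))"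
      by (simp add: norm_mult mult_ac)
  qed
  also have "\<dots> \<le> C * \<rho> ^ (n - 1) * norm (x - y)"
    using \<rho> by (simp add: C_def flip: sum_distrib_right) (simp add: algebra_simps)
  finally have le: "norm (poly \<omega> x - poly \<omega> y) \<le> C * \<rho> ^ (n - 1) * norm (x - y)" .
  show "norm (divided_difference \<omega> x y) \<le> C * \<rho> ^ (n - 1)"
  proof (cases "x = y")
    case True
    with C1 \<rho> show ?thesis by (simp add: divided_difference_def)
  next
    case False
    with le show ?thesis by (simp add: divided_difference_def norm_divide divide_le_eq)
  qed
qed

text \<open>For large \<open>z\<close> the leading term dominates, so the norm of
  \<open>poly f z\<close> is at least a fixed multiple of the \<open>d\<close>-th power of the norm
  of \<open>z\<close>. The remaining points of the fibres lie in a fixed disc.\<close>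

lemma fiber_norm_bound:
  assumes deg: "degree f > 0"
  obtains C where "C \<ge> 1"
    "\<And>x t. x \<in> fiber f t \<Longrightarrow> norm x \<le> C * root (degree f) (max 1 (norm t))"
proof -
  define d where "d = degree f"
  have d: "d > 0" using deg by (simp add: d_def)
  define a where "a = norm (lead_coeff f)"
  have a: "a > 0" using deg by (auto simp: a_def)
  obtain r where r: "\<And>z. r \<le> norm z \<Longrightarrow> a / 2 * norm z ^ d \<le> norm (poly f z)"
  proof -
    have "((\<lambda>z. poly f z / z ^ d) \<longlongrightarrow> lead_coeff f) at_infinity"
      unfolding d_def by (rule poly_divide_tendsto_aux)
    then have "((\<lambda>z. norm (poly f z / z ^ d)) \<longlongrightarrow> a) at_infinity"
      unfolding a_def by (rule tendsto_norm)
    then have "\<forall>\<^sub>F z in at_infinity. a / 2 < norm (poly f z / z ^ d)"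
      by (rule order_tendstoD) (use a in auto)
    then obtain b where b: "\<And>z. b \<le> norm z \<Longrightarrow> a / 2 < norm (poly f z / z ^ d)"
      by (auto simp: eventually_at_infinity)
    show thesis
    proof (rule that[of "max b 1"])
      fix z :: complex assume "max b 1 \<le> norm z"
      with b[of z] have "a / 2 < norm (poly f z) / norm z ^ d" "norm z > 0"
        by (auto simp: norm_divide norm_power)
      then show "a / 2 * norm z ^ d \<le> norm (poly f z)" by (simp add: less_divide_eq)
    qed
  qed
  \<comment> \<open>\<open>root d (2 / a)\<close> serves the points where the leading term
    dominates, \<open>r\<close> the others.\<close>
  define C where "C = max (max 1 r) (root d (2 / a))"
  show thesis
  proof (rule that[of C])
    show "C \<ge> 1" by (simp add: C_def)
    fix x t assume x: "x \<in> fiber f t"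
    define T where "T = max 1 (norm t)"
    have T: "T \<ge> 1" by (simp add: T_def)
    then have rT: "root d T \<ge> 1" using d by simp
    show "norm x \<le> C * root (degree f) (max 1 (norm t))"
    proof (cases "r \<le> norm x")
      case True
      have "a / 2 * norm x ^ d \<le> T" using r[OF True] x by (auto simp: fiber_def T_def)
      then have "norm x ^ d \<le> 2 / a * T" using a by (simp add: field_simps)
      then have "root d (norm x ^ d) \<le> root d (2 / a * T)" using d by simp
      then have "norm x \<le> root d (2 / a) * root d T"
        using d by (simp add: real_root_power_cancel flip: real_root_mult)
      also have "\<dots> \<le> C * root d T" using rT by (intro mult_right_mono) (auto simp: C_def)
      finally show ?thesis by (simp add: d_def T_def)
    next
      case False
      then have "norm x \<le> C * 1" by (simp add: C_def)
      also have "\<dots> \<le> C * root d T" using rT by (intro mult_left_mono) (auto simp: C_def)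
      finally show ?thesis by (simp add: d_def T_def)
    qed
  qed
qed

subsection \<open>The product over pairs of points of a fibre\<close>

text \<open>Ordered pairs: every unordered pair enters twice, which is what makes the zeros of
  \<open>pair_product\<close> double.\<close>

definition fiber_pairs :: "complex poly \<Rightarrow> complex \<Rightarrow> (complex \<times> complex) set" where
  "fiber_pairs f t = {(x, y). x \<in> fiber f t \<and> y \<in> fiber f t \<and> x \<noteq> y}"

text \<open>Symmetric in the points of the fibre, hence single valued in \<open>t\<close> without
  any choice of branches. Over a critical value only distinct points are paired, so the value there
  may differ from the continuous extension.\<close>

definition pair_product :: "complex poly \<Rightarrow> complex poly \<Rightarrow> complex \<Rightarrow> complex \<Rightarrow> complex" where
  "pair_product f \<omega> e t = (\<Prod>(x, y)\<in>fiber_pairs f t. divided_difference \<omega> x y + e)"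

lemma fiber_pairs_subset: "fiber_pairs f t \<subseteq> fiber f t \<times> fiber f t"
  by (auto simp: fiber_pairs_def)

lemma finite_fiber_pairs: "finite (fiber_pairs f t)" if "degree f > 0"
  using finite_subset[OF fiber_pairs_subset] finite_fiber[OF that] by blast

lemma card_fiber_pairs_le:
  assumes "degree f > 0"
  shows "card (fiber_pairs f t) \<le> degree f * (degree f - 1)"
proof -
  have "fiber_pairs f t = (SIGMA x:fiber f t. fiber f t - {x})"
    by (auto simp: fiber_pairs_def)
  then have "card (fiber_pairs f t) = (\<Sum>x\<in>fiber f t. card (fiber f t) - 1)"
    using finite_fiber[OF assms] by (simp add: card_SigmaI)
  also have "\<dots> \<le> degree f * (degree f - 1)"
    using card_fiber_le[OF assms, of t] by (auto intro!: mult_le_mono diff_le_mono)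
  finally show ?thesis .
qed

text \<open>Local sections carry the pairs over \<open>t0\<close> bijectively to the pairs over
  nearby \<open>t\<close>. The product thus gets a fixed index set and factors differentiable at
  \<open>t0\<close>, whose values at \<open>t0\<close> are known.\<close>

lemma pair_product_local:
  assumes deg: "degree f > 0" and t0: "t0 \<notin> critical_values f"
  obtains h where
    "\<And>a b. (a, b) \<in> fiber_pairs f t0 \<Longrightarrow> h (a, b) field_differentiable at t0"
    "\<And>a b. (a, b) \<in> fiber_pairs f t0 \<Longrightarrow> h (a, b) t0 = divided_difference \<omega> a b + e"
    "\<forall>\<^sub>F t in nhds t0. pair_product f \<omega> e t = (\<Prod>p\<in>fiber_pairs f t0. h p t)"
proof -
  obtain \<phi> where \<phi>: "\<And>a. a \<in> fiber f t0 \<Longrightarrow> \<phi> a t0 = a"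
    "\<And>a. a \<in> fiber f t0 \<Longrightarrow> \<phi> a field_differentiable at t0"
    "\<forall>\<^sub>F t in nhds t0. bij_betw (\<lambda>a. \<phi> a t) (fiber f t0) (fiber f t)"
    using fiber_local_sections[OF deg t0] by blast
  define h where "h = (\<lambda>p t. divided_difference \<omega> (\<phi> (fst p) t) (\<phi> (snd p) t) + e)"
  show thesis
  proof (rule that[of h])
    fix a b assume ab: "(a, b) \<in> fiber_pairs f t0"
    then have a: "a \<in> fiber f t0" and b: "b \<in> fiber f t0" and "a \<noteq> b" by (auto simp: fiber_pairs_def)
    have comp: "(\<lambda>t. poly \<omega> (\<phi> c t)) field_differentiable at t0" if "c \<in> fiber f t0" for c
    proof -
      have "poly \<omega> field_differentiable at (\<phi> c t0)"
        using poly_DERIV field_differentiable_def by blast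
      then show ?thesis
        using field_differentiable_compose[OF \<phi>(2)[OF that]] by (simp add: o_def)
    qed
    show "h (a, b) field_differentiable at t0"
      unfolding h_def divided_difference_def fst_conv snd_conv
      using \<phi>(1,2)[OF a] \<phi>(1,2)[OF b] comp[OF a] comp[OF b] \<open>a \<noteq> b\<close>
      by (intro field_differentiable_add field_differentiable_divide field_differentiable_diff) auto
    show "h (a, b) t0 = divided_difference \<omega> a b + e"
      using \<phi>(1)[OF a] \<phi>(1)[OF b] by (simp add: h_def)
  next
    show "\<forall>\<^sub>F t in nhds t0. pair_product f \<omega> e t = (\<Prod>p\<in>fiber_pairs f t0. h p t)"
      using \<phi>(3)
    proof eventually_elim
      case (elim t)
      have "bij_betw (\<lambda>p. (\<phi> (fst p) t, \<phi> (snd p) t)) (fiber_pairs f t0) (fiber_pairs f t)"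
      proof (rule bij_betw_imageI)
        show "inj_on (\<lambda>p. (\<phi> (fst p) t, \<phi> (snd p) t)) (fiber_pairs f t0)"
          using elim by (auto simp: inj_on_def bij_betw_def fiber_pairs_def)
        show "(\<lambda>p. (\<phi> (fst p) t, \<phi> (snd p) t)) ` fiber_pairs f t0 = fiber_pairs f t"
        proof (intro equalityI subsetI)
          fix q assume "q \<in> fiber_pairs f t"
          then obtain x y where q: "q = (x, y)" "x \<in> fiber f t" "y \<in> fiber f t" "x \<noteq> y"
            by (auto simp: fiber_pairs_def)
          then obtain a b where "a \<in> fiber f t0" "b \<in> fiber f t0" "x = \<phi> a t" "y = \<phi> b t"
            using elim unfolding bij_betw_def by (metis imageE)
          with q show "q \<in> (\<lambda>p. (\<phi> (fst p) t, \<phi> (snd p) t)) ` fiber_pairs f t0"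
            by (intro image_eqI[of _ _ "(a, b)"]) (auto simp: fiber_pairs_def)
        qed (use elim in \<open>auto simp: fiber_pairs_def bij_betw_def inj_on_def\<close>)
      qed
      from prod.reindex_bij_betw[OF this, of "\<lambda>(x, y). divided_difference \<omega> x y + e"]
      show ?case by (simp add: pair_product_def h_def)
    qed
  qed
qed

lemma prod_field_differentiable:
  "(\<And>i. i \<in> I \<Longrightarrow> h i field_differentiable at z) \<Longrightarrow> (\<lambda>t. \<Prod>i\<in>I. h i t) field_differentiable at z"
  for h :: "'i \<Rightarrow> complex \<Rightarrow> complex"
  by (induction I rule: infinite_finite_induct) (auto intro: field_differentiable_mult)

lemma field_differentiable_transform_eventually:
  assumes "g field_differentiable at z" "\<forall>\<^sub>F t in nhds z. f t = g t"
  shows "f field_differentiable at z"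
  using assms by (auto simp: field_differentiable_def DERIV_cong_ev)

lemma pair_product_holomorphic:
  assumes deg: "degree f > 0"
  shows "pair_product f \<omega> e holomorphic_on - critical_values f"
  unfolding holomorphic_on_def
proof
  fix t0 assume "t0 \<in> - critical_values f"
  then have t0: "t0 \<notin> critical_values f" by simp
  obtain h where "\<And>a b. (a, b) \<in> fiber_pairs f t0 \<Longrightarrow> h (a, b) field_differentiable at t0"
    and ev: "\<forall>\<^sub>F t in nhds t0. pair_product f \<omega> e t = (\<Prod>p\<in>fiber_pairs f t0. h p t)"
    using pair_product_local[OF deg t0, of \<omega> e] by metis
  then have "(\<lambda>t. \<Prod>p\<in>fiber_pairs f t0. h p t) field_differentiable at t0"
    by (intro prod_field_differentiable) auto
  with ev have "pair_product f \<omega> e field_differentiable at t0"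
    by (rule field_differentiable_transform_eventually[rotated])
  then show "pair_product f \<omega> e field_differentiable at t0 within - critical_values f"
    by (rule field_differentiable_at_within)
qed

text \<open>The divided difference is symmetric, so the factors of \<open>(x, y)\<close> and of
  \<open>(y, x)\<close> vanish together; the product rule then kills the derivative.\<close>

lemma pair_product_double_zero:
  assumes deg: "degree f > 0" and t0: "t0 \<notin> critical_values f"
    and xy: "(x, y) \<in> fiber_pairs f t0" and zero: "divided_difference \<omega> x y + e = 0"
  shows "(pair_product f \<omega> e has_field_derivative 0) (at t0)"
proof -
  obtain h where h: "\<And>a b. (a, b) \<in> fiber_pairs f t0 \<Longrightarrow> h (a, b) field_differentiable at t0"
    "\<And>a b. (a, b) \<in> fiber_pairs f t0 \<Longrightarrow> h (a, b) t0 = divided_difference \<omega> a b + e"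
    and ev: "\<forall>\<^sub>F t in nhds t0. pair_product f \<omega> e t = (\<Prod>p\<in>fiber_pairs f t0. h p t)"
    using pair_product_local[OF deg t0, of \<omega> e] by blast
  define P where "P = fiber_pairs f t0 - {(x, y)}"
  have yx: "(y, x) \<in> P" using xy by (auto simp: fiber_pairs_def P_def)
  have P: "(\<Prod>p\<in>fiber_pairs f t0. h p t) = h (x, y) t * (\<Prod>p\<in>P. h p t)" for t
    unfolding P_def using finite_fiber_pairs[OF deg] xy by (rule prod.remove)
  have "(\<lambda>t. \<Prod>p\<in>P. h p t) field_differentiable at t0"
    using h(1) by (intro prod_field_differentiable) (auto simp: P_def)
  then obtain v where v: "((\<lambda>t. \<Prod>p\<in>P. h p t) has_field_derivative v) (at t0)"
    by (auto simp: field_differentiable_def)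
  obtain u where u: "(h (x, y) has_field_derivative u) (at t0)"
    using h(1)[OF xy] by (auto simp: field_differentiable_def)
  have "h (x, y) t0 = 0" using h(2)[OF xy] zero by simp
  moreover have "h (y, x) t0 = 0"
    using h(2)[of y x] yx zero by (simp add: P_def divided_difference_commute)
  then have "(\<Prod>p\<in>P. h p t0) = 0"
    using yx finite_fiber_pairs[OF deg] by (auto simp: P_def)
  ultimately have "((\<lambda>t. \<Prod>p\<in>fiber_pairs f t0. h p t) has_field_derivative 0) (at t0)"
    unfolding P using DERIV_mult[OF u v] by simp
  with ev show ?thesis by (simp add: DERIV_cong_ev)
qed

text \<open>With \<open>d = degree f\<close> and \<open>r\<close> the \<open>d\<close>-th root of
  \<open>max 1 (norm t)\<close>, there are at most \<open>d * (d - 1)\<close> factors, each of size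
  O(\<open>r ^ (n - 1)\<close>). The factor \<open>d\<close> in the exponent turns \<open>r\<close>
  back into \<open>max 1 (norm t)\<close>.\<close>

lemma pair_product_bound:
  assumes deg: "degree f > 0" and n: "degree \<omega> \<le> n"
  obtains C where
    "\<And>t. norm (pair_product f \<omega> e t) \<le> C * max 1 (norm t) ^ ((degree f - 1) * (n - 1))"
proof -
  define d where "d = degree f"
  have d: "d > 0" using deg by (simp add: d_def)
  obtain A where A: "A \<ge> 1" "\<And>x t. x \<in> fiber f t \<Longrightarrow> norm x \<le> A * root d (max 1 (norm t))"
    using fiber_norm_bound[OF deg] unfolding d_def by blast
  obtain B where B: "B \<ge> 1"
    "\<And>x y \<rho>. \<lbrakk>norm x \<le> \<rho>; norm y \<le> \<rho>; 1 \<le> \<rho>\<rbrakk> \<Longrightarrow> norm (divided_difference \<omega> x y) \<le> B * \<rho> ^ (n - 1)"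
    using divided_difference_bound[OF n] by blast
  define C where "C = (B + norm e) * A ^ (n - 1)"
  have "1 * 1 \<le> (B + norm e) * A ^ (n - 1)"
    using A(1) B(1) by (intro mult_mono one_le_power add_increasing2) auto
  then have C: "C \<ge> 1" by (simp add: C_def)
  show thesis
  proof (rule that)
    fix t :: complex
    define T where "T = max 1 (norm t)"
    define r where "r = root d T"
    have "T \<ge> 1" by (simp add: T_def)
    then have r: "r \<ge> 1" "r ^ d = T" using d by (auto simp: r_def)
    have Ar: "A * r \<ge> 1" using mult_mono[OF A(1) r(1)] A(1) by simp
    have fac: "norm (divided_difference \<omega> x y + e) \<le> C * r ^ (n - 1)" if "(x, y) \<in> fiber_pairs f t" for x y
    proof -
      have "norm (divided_difference \<omega> x y) \<le> B * (A * r) ^ (n - 1)"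
        using that A(2) Ar by (intro B(2)) (auto simp: fiber_pairs_def r_def T_def)
      moreover have "norm e \<le> norm e * (A * r) ^ (n - 1)"
        using one_le_power[OF Ar, of "n - 1"] mult_left_mono[of 1 _ "norm e"] by simp
      ultimately have "norm (divided_difference \<omega> x y + e) \<le> B * (A * r) ^ (n - 1) + norm e * (A * r) ^ (n - 1)"
        by (intro norm_triangle_le) auto
      then show ?thesis by (simp add: C_def algebra_simps power_mult_distrib)
    qed
    \<comment> \<open>Since the bound of one factor is at least 1, it may be raised to the maximal
      number of pairs even over fibres with fewer points.\<close>
    have C': "1 \<le> C * r ^ (n - 1)"
      using mult_mono[OF C one_le_power[OF r(1), of "n - 1"]] C by simp
    have "norm (pair_product f \<omega> e t) \<le> (\<Prod>p\<in>fiber_pairs f t. C * r ^ (n - 1))"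
      unfolding pair_product_def prod_norm[symmetric] using fac by (intro prod_mono) auto
    also have "\<dots> = (C * r ^ (n - 1)) ^ card (fiber_pairs f t)" by simp
    also have "\<dots> \<le> (C * r ^ (n - 1)) ^ (d * (d - 1))"
      using card_fiber_pairs_le[OF deg] by (intro power_increasing C') (simp add: d_def)
    also have "\<dots> = C ^ (d * (d - 1)) * (r ^ d) ^ ((d - 1) * (n - 1))"
      by (simp add: power_mult_distrib mult_ac flip: power_mult)
    finally show "norm (pair_product f \<omega> e t)
        \<le> C ^ (d * (d - 1)) * max 1 (norm t) ^ ((degree f - 1) * (n - 1))"
      by (simp add: r(2)) (simp add: T_def d_def)
  qed
qed

section \<open>Extension across the critical values to a polynomial\<close>

text \<open>Riemann's theorem on removable singularities, applied to one point after
  another.\<close>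

lemma holomorphic_extend_finite:
  assumes "finite S" "f holomorphic_on - S"
    and "\<And>a. a \<in> S \<Longrightarrow> \<exists>B. \<forall>\<^sub>F z in at a. norm (f z) \<le> B"
  obtains g where "g holomorphic_on UNIV" "\<And>z. z \<notin> S \<Longrightarrow> g z = f z"
  using assms
proof (induction S arbitrary: f thesis rule: finite_induct)
  case empty
  then show ?case by auto
next
  case (insert a S)
  have op: "open (- S)" using insert.hyps(1) by (simp add: finite_imp_closed open_Compl)
  have eq: "- insert a S = - S - {a}" by auto
  have "\<exists>g. g holomorphic_on - S \<and> (\<forall>z\<in>- S - {a}. g z = f z)"
    using insert.prems insert.hyps op unfolding eq
    by (subst holomorphic_on_extend_bounded) (auto simp: interior_open)
  then obtain g where g: "g holomorphic_on - S" "\<And>z. z \<notin> insert a S \<Longrightarrow> g z = f z" by auto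
  \<comment> \<open>In a small punctured neighbourhood of \<open>b\<close> the extension
    \<open>g\<close> agrees with \<open>f\<close>, so it inherits the local bound that the induction
    hypothesis requires.\<close>
  have bd: "\<exists>B. \<forall>\<^sub>F z in at b. norm (g z) \<le> B" if b: "b \<in> S" for b
  proof -
    obtain B where B: "\<forall>\<^sub>F z in at b. norm (f z) \<le> B" using insert.prems b by blast
    have "open (- (insert a S - {b}))"
      using insert.hyps(1) by (intro open_Compl finite_imp_closed) simp
    then have "\<forall>\<^sub>F z in at b. z \<in> - (insert a S - {b})"
      using eventually_at_in_open' by blast
    moreover have "\<forall>\<^sub>F z in at b. z \<noteq> b" by (simp add: eventually_at_filter)
    ultimately have "\<forall>\<^sub>F z in at b. norm (g z) \<le> B" using B
      by eventually_elim (use g(2) in auto)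
    then show ?thesis by blast
  qed
  obtain g' where "g' holomorphic_on UNIV" "\<And>z. z \<notin> S \<Longrightarrow> g' z = g z"
    using insert.IH[OF _ g(1) bd] by blast
  then show ?case using g(2) by (intro insert.prems(1)[of g']) auto
qed

lemma Liouville_poly:
  assumes "g holomorphic_on UNIV" "\<And>z. A \<le> norm z \<Longrightarrow> norm (g z) \<le> B * norm z ^ n"
  obtains p where "degree p \<le> n" "g = poly p"
proof
  define p where "p = (\<Sum>k\<le>n. monom ((deriv ^^ k) g 0 / fact k) k)"
  show "degree p \<le> n"
    unfolding p_def by (intro degree_sum_le) (auto intro: order_trans[OF degree_monom_le])
  show "g = poly p"
    using Liouville_polynomial[OF assms] by (auto simp: p_def poly_sum poly_monom)
qed

text \<open>The growth bound is used twice: locally it makes the critical values removable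
  singularities, and at infinity it bounds the degree of the resulting entire function.\<close>

lemma pair_product_poly:
  assumes deg: "degree f > 0" and n: "degree \<omega> \<le> n"
  obtains p where "degree p \<le> (degree f - 1) * (n - 1)"
    "\<And>t. t \<notin> critical_values f \<Longrightarrow> pair_product f \<omega> e t = poly p t"
proof -
  let ?M = "(degree f - 1) * (n - 1)"
  obtain C where C: "\<And>t. norm (pair_product f \<omega> e t) \<le> C * max 1 (norm t) ^ ?M"
    using pair_product_bound[OF deg n] by blast
  have "\<exists>B. \<forall>\<^sub>F t in at a. norm (pair_product f \<omega> e t) \<le> B" for a
  proof -
    have "((\<lambda>t. C * max 1 (norm t) ^ ?M) \<longlongrightarrow> C * max 1 (norm a) ^ ?M) (at a)"
      by (intro tendsto_intros)
    then have "\<forall>\<^sub>F t in at a. C * max 1 (norm t) ^ ?M < C * max 1 (norm a) ^ ?M + 1"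
      by (rule order_tendstoD) auto
    then have "\<forall>\<^sub>F t in at a. norm (pair_product f \<omega> e t) \<le> C * max 1 (norm a) ^ ?M + 1"
      by eventually_elim (use C in \<open>meson less_imp_le order_trans\<close>)
    then show ?thesis by blast
  qed
  then obtain g where g: "g holomorphic_on UNIV"
    "\<And>t. t \<notin> critical_values f \<Longrightarrow> g t = pair_product f \<omega> e t"
    using holomorphic_extend_finite[OF finite_critical_values[OF deg] pair_product_holomorphic[OF deg]]
    by metis
  obtain b where b: "\<And>t. t \<in> critical_values f \<Longrightarrow> norm t \<le> b"
    using finite_imp_bounded[OF finite_critical_values[OF deg]] by (auto simp: bounded_iff)
  \<comment> \<open>Beyond \<open>b + 1\<close> there are no critical values, so \<open>g\<close> is
    the product there; the 1 in the maximum replaces \<open>max 1 (norm t)\<close> by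
    \<open>norm t\<close>.\<close>
  have "norm (g t) \<le> C * norm t ^ ?M" if "max 1 (b + 1) \<le> norm t" for t
    using C[of t] g(2)[of t] b[of t] that by force
  from Liouville_poly[OF g(1) this] show thesis using g(2) that by metis
qed

section \<open>Counting zeros of the integral\<close>

lemma double_roots_le_degree:
  fixes p :: "complex poly"
  assumes "p \<noteq> 0" "\<And>t. t \<in> T \<Longrightarrow> poly p t = 0 \<and> poly (pderiv p) t = 0"
  shows "2 * card T \<le> degree p"
proof -
  have sub: "T \<subseteq> {x. poly p x = 0}" using assms by auto
  have "order t p \<ge> 2" if "t \<in> T" for t
  proof -
    \<comment> \<open>If the derivative vanished, \<open>p\<close> would be a constant with a root,
      hence zero.\<close>
    have pd: "pderiv p \<noteq> 0"
      using assms that pderiv_iszero[of p] by auto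
    then have "order t p = Suc (order t (pderiv p))"
      using assms that by (intro order_pderiv) (auto simp: order_root)
    moreover have "order t (pderiv p) \<noteq> 0" using pd assms(2)[OF that] by (auto simp: order_root)
    ultimately show ?thesis by simp
  qed
  then have "(\<Sum>t\<in>T. 2) \<le> (\<Sum>t\<in>T. order t p)" by (rule sum_mono)
  also have "\<dots> \<le> (\<Sum>t | poly p t = 0. order t p)"
    using sub poly_roots_finite[OF assms(1)] by (intro sum_mono2) auto
  also have "\<dots> \<le> degree p" using assms(1) by (rule sum_order_le_degree)
  finally show ?thesis by simp
qed

text \<open>The images under \<open>g\<close> of disjoint balls around the zeros are open and
  contain 0. Their intersection is an uncountable set of values, each attained at least once in
  every ball, and the finite set \<open>E\<close> cannot exhaust it.\<close>

lemma perturb_zeros: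
  assumes g: "g holomorphic_on D" "open D" "connected D"
    and nz: "t0 \<in> D" "g t0 \<noteq> 0" and Z: "finite Z" "Z \<subseteq> D" "\<And>z. z \<in> Z \<Longrightarrow> g z = 0"
    and E: "finite E"
  obtains e T where "e \<notin> E" "T \<subseteq> D" "finite T" "card T = card Z" "\<And>t. t \<in> T \<Longrightarrow> g t = e"
proof (cases "Z = {}")
  case True
  obtain e where "e \<notin> E" using ex_new_if_finite[OF infinite_UNIV_char_0 E] by blast
  then show ?thesis using that[of e "{}"] True by auto
next
  case False
  then have nc: "\<not> g constant_on D" using nz Z unfolding constant_on_def by (metis ex_in_conv subsetD)
  obtain r where r: "r > 0" "\<And>z. z \<in> Z \<Longrightarrow> ball z r \<subseteq> D" "disjoint_family_on (\<lambda>z. ball z r) Z"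
  proof -
    \<comment> \<open>The factor 2 makes balls of the common minimal radius around different zeros
      disjoint.\<close>
    have "\<exists>s>0. ball z s \<subseteq> D \<and> (\<forall>w\<in>Z. w \<noteq> z \<longrightarrow> 2 * s \<le> dist z w)" if z: "z \<in> Z" for z
    proof -
      obtain s where s: "s > 0" "ball z s \<subseteq> D"
        using g(2) Z(2) z by (meson open_contains_ball subsetD)
      obtain d where d: "d > 0" "\<forall>w\<in>Z. w \<noteq> z \<longrightarrow> d \<le> dist z w"
        using finite_set_avoid[OF Z(1)] by blast
      have "ball z (min s (d / 2)) \<subseteq> D" using s(2) subset_ball[of "min s (d / 2)" s z] by auto
      with s d show ?thesis by (intro exI[of _ "min s (d / 2)"]) (auto simp: min_def)
    qed
    then obtain s where s: "\<And>z. z \<in> Z \<Longrightarrow> s z > 0" "\<And>z. z \<in> Z \<Longrightarrow> ball z (s z) \<subseteq> D"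
      "\<And>z w. \<lbrakk>z \<in> Z; w \<in> Z; w \<noteq> z\<rbrakk> \<Longrightarrow> 2 * s z \<le> dist z w"
      by metis
    define r where "r = Min (s ` Z)"
    have r: "r \<le> s z" if "z \<in> Z" for z using that Z(1) by (simp add: r_def)
    show thesis
    proof (rule that[of r])
      show "r > 0" using s(1) Z(1) False by (simp add: r_def)
      show "ball z r \<subseteq> D" if "z \<in> Z" for z
        using s(2)[OF that] subset_ball[OF r[OF that], of z] by blast
      show "disjoint_family_on (\<lambda>z. ball z r) Z"
        unfolding disjoint_family_on_def
      proof (intro ballI impI disjoint_iff[THEN iffD2] allI notI)
        fix z w v assume zw: "z \<in> Z" "w \<in> Z" "z \<noteq> w" and v: "v \<in> ball z r" "v \<in> ball w r"
        then have "dist z w < 2 * r" using dist_triangle2[of z w v] by auto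
        then show False using s(3)[of z w] r[of z] zw by auto
      qed
    qed
  qed
  define W where "W = (\<Inter>z\<in>Z. g ` ball z r)"
  have "open (g ` ball z r)" if "z \<in> Z" for z
    using g nc r(2)[OF that] by (intro open_mapping_thm[of g D]) auto
  then have "open W" unfolding W_def using Z(1) by (intro open_INT) auto
  moreover have "0 \<in> W"
    unfolding W_def using Z(3) r(1) by (force simp: image_iff intro: centre_in_ball[THEN iffD2])
  ultimately have "uncountable W"
    by (meson countable_subset open_contains_ball uncountable_ball)
  then have "\<not> W \<subseteq> E" using E countable_finite countable_subset by blast
  then obtain e where e: "e \<in> W" "e \<notin> E" by blast
  then have "\<forall>z\<in>Z. \<exists>t\<in>ball z r. g t = e" by (auto simp: W_def)
  then obtain \<tau> where \<tau>: "\<And>z. z \<in> Z \<Longrightarrow> \<tau> z \<in> ball z r \<and> g (\<tau> z) = e" by metis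
  have "inj_on \<tau> Z"
    using \<tau> r(3) unfolding inj_on_def disjoint_family_on_def by (metis disjoint_iff)
  show thesis
  proof (rule that[of e "\<tau> ` Z"])
    show "\<tau> ` Z \<subseteq> D" using \<tau> r(2) by blast
  qed (use e \<tau> Z(1) card_image[OF \<open>inj_on \<tau> Z\<close>] in auto)
qed

lemma cycle_zeros_bound:
  assumes mn: "degree f \<le> m" "degree \<omega> \<le> n"
    and D: "open D" "connected D" "D \<subseteq> - critical_values f"
    and x: "continuous_on D x" "continuous_on D y"
    and fib: "\<And>t. t \<in> D \<Longrightarrow> x t \<in> fiber f t \<and> y t \<in> fiber f t \<and> x t \<noteq> y t"
    and nz: "t0 \<in> D" "poly \<omega> (x t0) \<noteq> poly \<omega> (y t0)"
    and Z: "finite Z" "Z \<subseteq> D" "\<And>t. t \<in> Z \<Longrightarrow> poly \<omega> (x t) = poly \<omega> (y t)"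
  shows "2 * card Z \<le> (m - 1) * (n - 1)"
proof -
  \<comment> \<open>For constant \<open>f\<close> the only value with a nonempty fibre is itself
    critical, which contradicts the nonempty fibre over \<open>t0\<close>.\<close>
  have deg: "degree f > 0"
  proof (rule ccontr)
    assume "\<not> degree f > 0"
    then obtain c where "f = [:c:]" by (auto elim: degree_eq_zeroE)
    then show False using fib[OF nz(1)] nz(1) D(3) by (auto simp: fiber_def critical_values_def split: if_splits)
  qed
  define g where "g = (\<lambda>t. divided_difference \<omega> (x t) (y t))"
  have hx: "x holomorphic_on D" and hy: "y holomorphic_on D"
    unfolding holomorphic_on_def using section_field_differentiable[OF D(1)] D(3) x fib
    by (meson ComplD field_differentiable_at_within subsetD)+
  have hp: "(\<lambda>t. poly \<omega> (u t)) holomorphic_on D" if "u holomorphic_on D" for u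
    using holomorphic_on_compose[OF that, of "poly \<omega>"] by (simp add: o_def holomorphic_intros)
  have hg: "g holomorphic_on D"
    unfolding g_def divided_difference_def using hx hy fib by (intro holomorphic_intros hp) auto
  have g0: "g t = 0 \<longleftrightarrow> poly \<omega> (x t) = poly \<omega> (y t)" if "t \<in> D" for t
    using fib[OF that] by (auto simp: g_def divided_difference_def)
  \<comment> \<open>The values of the divided difference over \<open>t0\<close>. With
    \<open>e\<close> outside \<open>E\<close>, no factor of the product with shift
    \<open>- e\<close> vanishes at \<open>t0\<close>, so the polynomial \<open>p\<close> is nonzero,
    while every solution of \<open>g t = e\<close> is a double root.\<close>
  define E where "E = (\<lambda>(a, b). divided_difference \<omega> a b) ` fiber_pairs f t0"
  have "finite E" using finite_fiber_pairs[OF deg] by (simp add: E_def)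
  then obtain e T where e: "e \<notin> E" and T: "T \<subseteq> D" "finite T" "card T = card Z" "\<And>t. t \<in> T \<Longrightarrow> g t = e"
    using perturb_zeros[OF hg D(1,2) nz(1) _ Z(1,2)] g0 nz Z by (metis subsetD)
  obtain p where p: "degree p \<le> (degree f - 1) * (n - 1)"
    "\<And>t. t \<notin> critical_values f \<Longrightarrow> pair_product f \<omega> (- e) t = poly p t"
    using pair_product_poly[OF deg mn(2)] by metis
  have "pair_product f \<omega> (- e) t0 \<noteq> 0"
    using e finite_fiber_pairs[OF deg] by (auto simp: pair_product_def E_def)
  then have p0: "p \<noteq> 0" using p(2)[of t0] nz(1) D(3) by auto
  have "poly p t = 0 \<and> poly (pderiv p) t = 0" if t: "t \<in> T" for t
  proof -
    have tD: "t \<in> D" and nt: "t \<notin> critical_values f" using t T D(3) by auto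
    have xy: "(x t, y t) \<in> fiber_pairs f t" using fib[OF tD] by (simp add: fiber_pairs_def)
    have zero: "divided_difference \<omega> (x t) (y t) + (- e) = 0" using T(4)[OF t] by (simp add: g_def)
    have "pair_product f \<omega> (- e) t = 0"
      unfolding pair_product_def using xy zero finite_fiber_pairs[OF deg]
      by (intro prod_zero) (auto intro!: bexI[of _ "(x t, y t)"])
    moreover have "\<forall>\<^sub>F s in nhds t. s \<in> D" using D(1) tD by (rule eventually_nhds_in_open)
    then have "\<forall>\<^sub>F s in nhds t. pair_product f \<omega> (- e) s = poly p s"
      by eventually_elim (use p(2) D(3) in auto)
    then have "(poly p has_field_derivative 0) (at t)"
      using pair_product_double_zero[OF deg nt xy zero] by (simp add: DERIV_cong_ev)
    then have "poly (pderiv p) t = 0" using poly_DERIV DERIV_unique by blast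
    ultimately show ?thesis using p(2)[OF nt] by simp
  qed
  then have "2 * card T \<le> degree p" by (rule double_roots_le_degree[OF p0])
  also have "\<dots> \<le> (m - 1) * (n - 1)"
    using p(1) mn(1) by (meson diff_le_mono le_trans mult_le_mono1)
  finally show ?thesis by (simp add: T)
qed

subsection \<open>Lower bound\<close>

text \<open>Gaussian elimination, by induction on the set \<open>P\<close> of equations with
  unknowns indexed by \<open>K\<close>: a nontrivial equation removes one equation and one
  unknown.\<close>

lemma homogeneous_system_nontrivial:
  fixes a :: "'k \<Rightarrow> 'p \<Rightarrow> 'a :: field"
  assumes "finite P" "finite K" "card P < card K"
  obtains c where "\<exists>k\<in>K. c k \<noteq> 0" "\<And>p. p \<in> P \<Longrightarrow> (\<Sum>k\<in>K. c k * a k p) = 0"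
  using assms
proof (induction P arbitrary: K a thesis rule: finite_induct)
  case empty
  then have "K \<noteq> {}" by auto
  then show ?case by (intro empty(1)[of "\<lambda>_. 1"]) auto
next
  case (insert p P)
  show ?case
  proof (cases "\<forall>k\<in>K. a k p = 0")
    case True
    have "card P < card K" using insert by simp
    then obtain c where "\<exists>k\<in>K. c k \<noteq> 0" "\<And>q. q \<in> P \<Longrightarrow> (\<Sum>k\<in>K. c k * a k q) = 0"
      using insert.IH[of K a] insert.prems(2) by blast
    with True show ?thesis by (intro insert.prems(1)[of c]) auto
  next
    case False
    then obtain k0 where k0: "k0 \<in> K" "a k0 p \<noteq> 0" by blast
    \<comment> \<open>The system after eliminating the unknown \<open>k0\<close> by means of
      equation \<open>p\<close>.\<close>
    define b where "b = (\<lambda>k q. a k q - a k p / a k0 p * a k0 q)"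
    have "finite (K - {k0})" "card P < card (K - {k0})"
      using insert.prems insert.hyps k0(1) by auto
    then obtain c where c: "\<exists>k\<in>K - {k0}. c k \<noteq> 0"
      "\<And>q. q \<in> P \<Longrightarrow> (\<Sum>k\<in>K - {k0}. c k * b k q) = 0"
      using insert.IH[of "K - {k0}" b] by blast
    \<comment> \<open>The value at \<open>k0\<close> is the one forced by equation
      \<open>p\<close>.\<close>
    define c' where "c' = c(k0 := - (\<Sum>k\<in>K - {k0}. c k * (a k p / a k0 p)))"
    have eq: "(\<Sum>k\<in>K. c' k * a k q) = (\<Sum>k\<in>K - {k0}. c k * b k q)" for q
    proof -
      have "(\<Sum>k\<in>K. c' k * a k q) = c' k0 * a k0 q + (\<Sum>k\<in>K - {k0}. c' k * a k q)"
        using insert.prems(2) k0(1) by (rule sum.remove)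
      also have "(\<Sum>k\<in>K - {k0}. c' k * a k q) = (\<Sum>k\<in>K - {k0}. c k * a k q)"
        by (intro sum.cong) (auto simp: c'_def)
      also have "c' k0 * a k0 q = - (\<Sum>k\<in>K - {k0}. c k * (a k p / a k0 p) * a k0 q)"
        by (simp add: c'_def sum_distrib_right)
      finally show ?thesis by (simp add: b_def sum_subtractf algebra_simps)
    qed
    have "b k p = 0" for k using k0(2) by (simp add: b_def)
    then have "(\<Sum>k\<in>K. c' k * a k q) = 0" if "q \<in> insert p P" for q
      using that c(2) unfolding eq by auto
    moreover have "\<exists>k\<in>K. c' k \<noteq> 0" using c(1) by (auto simp: c'_def)
    ultimately show ?thesis using insert.prems(1) by blast
  qed
qed

text \<open>Counts the exponents available for the lower bound; the excluded ones are
  \<open>m * j\<close> with \<open>j\<close> from 1 to \<open>n div m\<close>.\<close>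

lemma card_not_dvd:
  assumes "m > 0"
  shows "card {k \<in> {1..n}. \<not> m dvd k} = n - n div m"
proof -
  have "{k \<in> {1..n}. m dvd k} = (\<lambda>j. m * j) ` {1..n div m}"
    using assms by (auto simp: less_eq_div_iff_mult_less_eq mult.commute elim!: dvdE)
  moreover have "inj_on (\<lambda>j. m * j) {1..n div m}" using assms by (auto simp: inj_on_def)
  ultimately have dvd: "card {k \<in> {1..n}. m dvd k} = n div m" by (simp add: card_image)
  have "card ({1..n} - {k \<in> {1..n}. m dvd k}) = card {1..n} - card {k \<in> {1..n}. m dvd k}"
    by (intro card_Diff_subset) auto
  moreover have "{1..n} - {k \<in> {1..n}. m dvd k} = {k \<in> {1..n}. \<not> m dvd k}" by blast
  ultimately have "card {k \<in> {1..n}. \<not> m dvd k} = card {1..n} - card {k \<in> {1..n}. m dvd k}"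
    by (simp only:)
  with dvd show ?thesis by simp
qed

lemma Z_complex_lower:
  assumes m: "m \<ge> 2" and n: "n \<ge> 1"
  shows "enat (n - 1 - n div m) \<le> Z_complex m n"
proof -
  define N where "N = n - 1 - n div m"
  define K where "K = {k \<in> {1..n}. \<not> m dvd k}"
  define f :: "complex poly" where "f = monom 1 m"
  define \<zeta> where "\<zeta> = exp (2 * of_real pi * \<i> * (of_nat 1 / of_nat m))"
  \<comment> \<open>A branch of the \<open>m\<close>-th root. It is continuous on the right
    half-plane \<open>D\<close>, which avoids the cut of \<open>Ln\<close> and the only critical
    value 0.\<close>
  define s where "s = (\<lambda>t::complex. exp (Ln t / of_nat m))"
  define D where "D = {t. Re t > 0}"
  \<comment> \<open>The prescribed zeros: \<open>N\<close> distinct points of \<open>D\<close>, here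
    positive integers.\<close>
  define P where "P = (of_nat :: nat \<Rightarrow> complex) ` {1..N}"
  \<comment> \<open>Ensures \<open>n div m < n\<close>, so that the subtraction in \<open>N\<close>
    is not truncated and \<open>card P\<close> is one less than \<open>card K\<close>.\<close>
  have "n div m \<le> n div 2" using m by (intro div_le_mono2) auto
  then have "n div m < n" using n by linarith
  moreover have K: "finite K" "card K = n - n div m"
    unfolding K_def using m by (simp, intro card_not_dvd, simp)
  moreover have P: "finite P" "card P = N" "P \<subseteq> D"
    by (auto simp: P_def D_def card_image inj_on_def)
  ultimately have "card P < card K" by (simp add: N_def)
  then obtain c where c: "\<exists>k\<in>K. c k \<noteq> 0" "\<And>t. t \<in> P \<Longrightarrow> (\<Sum>k\<in>K. c k * s t ^ k) = 0"
    using homogeneous_system_nontrivial[OF P(1) K(1), of "\<lambda>k t. s t ^ k"] by blast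
  have \<zeta>k: "\<zeta> ^ k = 1 \<longleftrightarrow> m dvd k" for k
  proof -
    have "\<zeta> ^ k = exp (2 * of_real pi * \<i> * (of_nat k / of_nat m))"
      unfolding \<zeta>_def by (simp add: field_simps flip: exp_of_nat_mult)
    with m show ?thesis using complex_root_unity_eq_1[of m k] by simp
  qed
  have \<zeta>1: "\<zeta> \<noteq> 1" using \<zeta>k[of 1] m by simp
  have \<zeta>m: "\<zeta> ^ m = 1" using \<zeta>k[of m] by simp
  have sm: "s t ^ m = t" if "t \<in> D" for t
  proof -
    have "t \<noteq> 0" using that by (auto simp: D_def)
    then show ?thesis using m by (simp add: s_def flip: exp_of_nat_mult)
  qed
  have s0: "s t \<noteq> 0" for t by (simp add: s_def)
  have contD: "continuous_on D s"
    unfolding s_def D_def using m by (intro continuous_intros) (auto simp: complex_nonpos_Reals_iff)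
  \<comment> \<open>Integration multiplies the coefficient of degree \<open>k\<close> by
    \<open>1 - \<zeta> ^ k\<close>. This is nonzero on \<open>K\<close> because
    \<open>\<zeta>\<close> is a primitive root of unity, so it can be divided out in
    advance.\<close>
  define \<omega> where "\<omega> = (\<Sum>k\<in>K. monom (c k / (1 - \<zeta> ^ k)) k)"
  have deg\<omega>: "degree \<omega> \<le> n"
    unfolding \<omega>_def using K(1) by (intro degree_sum_le) (auto simp: K_def intro: order_trans[OF degree_monom_le])
  have diff: "poly \<omega> z - poly \<omega> (\<zeta> * z) = (\<Sum>k\<in>K. c k * z ^ k)" for z
  proof -
    have "poly \<omega> z - poly \<omega> (\<zeta> * z) =
        (\<Sum>k\<in>K. c k / (1 - \<zeta> ^ k) * z ^ k - c k / (1 - \<zeta> ^ k) * (\<zeta> * z) ^ k)"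
      by (simp add: \<omega>_def poly_sum poly_monom sum_subtractf)
    also have "\<dots> = (\<Sum>k\<in>K. c k / (1 - \<zeta> ^ k) * (1 - \<zeta> ^ k) * z ^ k)"
      by (simp add: power_mult_distrib algebra_simps diff_divide_distrib)
    also have "\<dots> = (\<Sum>k\<in>K. c k * z ^ k)"
      by (intro sum.cong) (auto simp: \<zeta>k K_def)
    finally show ?thesis .
  qed
  define \<gamma> where "\<gamma> = (\<lambda>t. frag_of (s t) - frag_of (\<zeta> * s t))"
  have ne: "s t \<noteq> \<zeta> * s t" for t using \<zeta>1 s0[of t] by simp
  have int: "chain_integral (\<gamma> t) \<omega> = (\<Sum>k\<in>K. c k * s t ^ k)" for t
    using chain_integral_simple_cycle[OF ne] diff by (simp add: \<gamma>_def)
  have "continuous_simple_cycle_family f D \<gamma>"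
    unfolding continuous_simple_cycle_family_def
    using ne sm \<zeta>m contD
    by (intro exI[of _ s] exI[of _ "\<lambda>t. \<zeta> * s t"])
      (auto simp: \<gamma>_def fiber_def f_def poly_monom power_mult_distrib intro!: continuous_intros)
  moreover have "simply_connected_domain D"
  proof -
    have "open D" "convex D" "1 \<in> D"
      by (auto simp: D_def open_halfspace_Re_gt convex_halfspace_Re_gt)
    then show ?thesis
      by (auto simp: simply_connected_domain_def convex_connected convex_imp_simply_connected)
  qed
  moreover have "D \<subseteq> - critical_values f"
    using m by (auto simp: D_def critical_values_def f_def poly_monom pderiv_monom power_0_left)
  \<comment> \<open>Otherwise a nonzero polynomial would vanish on \<open>s\<close> applied to
    \<open>D\<close>, an infinite set because \<open>s\<close> is injective on the infinite set
    \<open>D\<close>.\<close>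
  moreover have "\<exists>t\<in>D. chain_integral (\<gamma> t) \<omega> \<noteq> 0"
  proof (rule ccontr)
    assume "\<not> (\<exists>t\<in>D. chain_integral (\<gamma> t) \<omega> \<noteq> 0)"
    moreover define q where "q = (\<Sum>k\<in>K. monom (c k) k)"
    ultimately have "s ` D \<subseteq> {z. poly q z = 0}" by (auto simp: int poly_sum poly_monom)
    moreover have "q \<noteq> 0"
    proof -
      obtain k where "k \<in> K" "c k \<noteq> 0" using c(1) by blast
      then have "coeff q k \<noteq> 0" using K(1) by (simp add: q_def coeff_sum if_distrib sum.delta cong: if_cong)
      then show ?thesis by auto
    qed
    ultimately have "finite (s ` D)" using poly_roots_finite finite_subset by blast
    moreover have "inj_on s D" using sm by (metis inj_onI)
    ultimately have "finite D" using finite_imageD by blast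
    moreover have "(of_nat :: nat \<Rightarrow> complex) ` {1..} \<subseteq> D" by (auto simp: D_def)
    ultimately have "finite ((of_nat :: nat \<Rightarrow> complex) ` {1..})" using finite_subset by blast
    then show False by (auto dest!: finite_imageD simp: inj_on_def infinite_Ici)
  qed
  moreover have "degree f \<le> m" by (simp add: f_def degree_monom_le)
  ultimately have "number_of_zeros (\<lambda>t. chain_integral (\<gamma> t) \<omega>) D \<le> Z_complex m n"
    unfolding Z_complex_def using deg\<omega> by (intro Sup_upper) blast
  moreover have "enat N \<le> number_of_zeros (\<lambda>t. chain_integral (\<gamma> t) \<omega>) D"
  proof -
    have "P \<subseteq> {t \<in> D. chain_integral (\<gamma> t) \<omega> = 0}" using P(3) c(2) by (auto simp: int)
    then show ?thesis
      using card_mono[of "{t \<in> D. chain_integral (\<gamma> t) \<omega> = 0}" P] P(2) by (auto simp: number_of_zeros_def)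
  qed
  ultimately show ?thesis by (simp add: N_def)
qed

subsection \<open>The two bounds for the supremum\<close>

text \<open>Bounding all finite sets of zeros also rules out infinitely many zeros, since an
  infinite set has finite subsets of every size.\<close>

lemma number_of_zeros_le:
  assumes "\<And>Z. \<lbrakk>finite Z; Z \<subseteq> {t \<in> D. h t = 0}\<rbrakk> \<Longrightarrow> card Z \<le> k"
  shows "number_of_zeros h D \<le> enat k"
proof -
  have "finite {t \<in> D. h t = 0}"
    using assms infinite_arbitrarily_large[of "{t \<in> D. h t = 0}" "Suc k"] by (metis Suc_n_not_le_n)
  then show ?thesis using assms by (simp add: number_of_zeros_def)
qed

lemma Z_complex_upper: "Z_complex m n \<le> enat ((m - 1) * (n - 1) div 2)"
  unfolding Z_complex_def
proof (rule Sup_least, clarify)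
  fix f \<omega> D \<gamma> t0
  assume mn: "degree f \<le> m" "degree \<omega> \<le> n" and D: "simply_connected_domain D" "D \<subseteq> - critical_values f"
    and \<gamma>: "continuous_simple_cycle_family f D \<gamma>" and t0: "t0 \<in> D" "chain_integral (\<gamma> t0) \<omega> \<noteq> 0"
  obtain x y where x: "continuous_on D x" "continuous_on D y"
    and xy: "\<And>t. t \<in> D \<Longrightarrow> x t \<in> fiber f t \<and> y t \<in> fiber f t \<and> x t \<noteq> y t"
    and \<gamma>_eq: "\<And>t. t \<in> D \<Longrightarrow> \<gamma> t = frag_of (x t) - frag_of (y t)"
    using \<gamma> unfolding continuous_simple_cycle_family_def by blast
  have int: "chain_integral (\<gamma> t) \<omega> = poly \<omega> (x t) - poly \<omega> (y t)" if "t \<in> D" for t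
    using chain_integral_simple_cycle xy[OF that] \<gamma>_eq[OF that] by simp
  show "number_of_zeros (\<lambda>t. chain_integral (\<gamma> t) \<omega>) D \<le> enat ((m - 1) * (n - 1) div 2)"
  proof (rule number_of_zeros_le)
    fix Z assume Z: "finite Z" "Z \<subseteq> {t \<in> D. chain_integral (\<gamma> t) \<omega> = 0}"
    have "2 * card Z \<le> (m - 1) * (n - 1)"
    proof (rule cycle_zeros_bound[OF mn _ _ D(2) x xy t0(1) _ Z(1)])
      show "open D" "connected D" using D(1) by (auto simp: simply_connected_domain_def)
      show "poly \<omega> (x t0) \<noteq> poly \<omega> (y t0)" using t0 int by simp
      show "Z \<subseteq> D" "\<And>t. t \<in> Z \<Longrightarrow> poly \<omega> (x t) = poly \<omega> (y t)" using Z(2) int by auto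
    qed
    then show "card Z \<le> (m - 1) * (n - 1) div 2" by simp
  qed
qed

theorem theorem1:
  fixes m n :: nat
  assumes "m \<ge> 2" and "n \<ge> 1"
  shows "ereal (real n - 1 - real_of_int \<lfloor>real n / real m\<rfloor>) \<le> ereal_of_enat (Z_complex m n)
       \<and> ereal_of_enat (Z_complex m n) \<le> ereal ((real m - 1) * (real n - 1) / 2)"
proof
  \<comment> \<open>As \<open>n div m + 1 \<le> n\<close>, the truncated difference of naturals
    equals the real lower bound, whose floor is \<open>n div m\<close>.\<close>
  have "n div m \<le> n div 2" using assms(1) by (intro div_le_mono2) auto
  then have "n div m + 1 \<le> n" using assms(2) by linarith
  then have "real n - 1 - real_of_int \<lfloor>real n / real m\<rfloor> = real (n - 1 - n div m)"
    by (simp add: floor_divide_of_nat_eq)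
  then show "ereal (real n - 1 - real_of_int \<lfloor>real n / real m\<rfloor>) \<le> ereal_of_enat (Z_complex m n)"
    using Z_complex_lower[OF assms] ereal_of_enat_le_iff[of "enat (n - 1 - n div m)"] by simp
  \<comment> \<open>The bound for the supremum is rounded down to an integer; undoing the rounding
    only enlarges it.\<close>
  have "real ((m - 1) * (n - 1) div 2) \<le> real ((m - 1) * (n - 1)) / 2"
    using of_nat_mono[of "2 * ((m - 1) * (n - 1) div 2)" "(m - 1) * (n - 1)"] by (simp del: of_nat_mult)
  also have "\<dots> = (real m - 1) * (real n - 1) / 2" using assms by (simp add: of_nat_diff)
  finally have "ereal (real ((m - 1) * (n - 1) div 2)) \<le> ereal ((real m - 1) * (real n - 1) / 2)" by simp
  moreover have "ereal_of_enat (Z_complex m n) \<le> ereal (real ((m - 1) * (n - 1) div 2))"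
    using Z_complex_upper[of m n] ereal_of_enat_le_iff[of _ "enat ((m - 1) * (n - 1) div 2)"] by simp
  ultimately show "ereal_of_enat (Z_complex m n) \<le> ereal ((real m - 1) * (real n - 1) / 2)"
    by (rule order_trans[rotated])
qed

end
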